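(* Let $F$ be a normed lattice with closed unit ball $B_F$. The following conditions are equivalent: (i) $F$ is demicontinuous; (ii) the common order and uo adherence of $B_F$ in $F$ is norm bounded; (iii) order adherence preserves norm bounded sets (i.e. the order adherence of every norm bounded subset of $F$ is norm bounded); (iii') uo adherence preserves norm bounded sets (i.e. the uo adherence of every norm bounded subset of $F$ is norm bounded).
   Context: A normed lattice is a real vector lattice with a lattice (solid) norm; norm completeness is not assumed. $P\uparrow f$ ($P\downarrow f$) means that $P$ is upward (downward) directed with supremum (infimum) $f$. A net $(f_p)$ in a vector lattice $F$ order converges to $f$ if there is $Q\subset F$ with $Q\downarrow 0$ such that for every $q\in Q$ there is $p_q$ with $|f_p-f|\le q$ whenever $p\ge p_q$. It uo converges to $f$ if $|f_p-f|\wedge e$ order converges to $0$ for every $e\in F_+$. The order (uo) adherence of a set is the set of all order (uo) limits in $F$ of nets of its elements. For solid sets, in particular for $B_F$, the order adherence and the uo adherence coincide. $F$ is demicontinuous if there is $r\ge 1$ such that whenever $P\subset B_F\cap F_+$ and $f\in F$ satisfy $P\uparrow f$, then $\|f\|\le r$. *)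

theory Defs
  imports "HOL-Analysis.Analysis" "HOL-Library.Lattice_Algebras" "HOL-Library.Lub_Glb"
begin

class normed_lattice = real_normed_vector + ordered_real_vector + lattice_ab_group_add_abs +
  assumes norm_solid: "\<bar>x\<bar> \<le> \<bar>y\<bar> \<Longrightarrow> norm x \<le> norm y"

definition directed_on :: "'i set \<Rightarrow> ('i \<Rightarrow> 'i \<Rightarrow> bool) \<Rightarrow> bool"
  where "directed_on I le \<longleftrightarrow> I \<noteq> {} \<and> (\<forall>i\<in>I. le i i) \<and>
    (\<forall>i\<in>I. \<forall>j\<in>I. \<forall>k\<in>I. le i j \<longrightarrow> le j k \<longrightarrow> le i k) \<and>
    (\<forall>i\<in>I. \<forall>j\<in>I. \<exists>k\<in>I. le i k \<and> le j k)"

definition up_to :: "'a::order set \<Rightarrow> 'a \<Rightarrow> bool"  (infix \<open>\<up>\<close> 50)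
  where "P \<up> f \<longleftrightarrow> directed_on P (\<le>) \<and> isLub UNIV P f"

definition down_to :: "'a::order set \<Rightarrow> 'a \<Rightarrow> bool"  (infix \<open>\<down>\<close> 50)
  where "P \<down> f \<longleftrightarrow> directed_on P (\<ge>) \<and> isGlb UNIV P f"

definition order_converges ::
    "'i set \<Rightarrow> ('i \<Rightarrow> 'i \<Rightarrow> bool) \<Rightarrow> ('i \<Rightarrow> 'a::lattice_ab_group_add_abs) \<Rightarrow> 'a \<Rightarrow> bool"
  where "order_converges I le f l \<longleftrightarrow>
    (\<exists>Q. Q \<down> 0 \<and> (\<forall>q\<in>Q. \<exists>p\<^sub>q\<in>I. \<forall>p\<in>I. le p\<^sub>q p \<longrightarrow> \<bar>f p - l\<bar> \<le> q))"

definition uo_converges ::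
    "'i set \<Rightarrow> ('i \<Rightarrow> 'i \<Rightarrow> bool) \<Rightarrow> ('i \<Rightarrow> 'a::lattice_ab_group_add_abs) \<Rightarrow> 'a \<Rightarrow> bool"
  where "uo_converges I le f l \<longleftrightarrow>
    (\<forall>e\<ge>0. order_converges I le (\<lambda>p. inf \<bar>f p - l\<bar> e) 0)"

text \<open>
  An adherence collects the limits of all nets in \<open>A\<close>, over arbitrary directed index sets. HOL
  cannot quantify over the index type inside a definition, so the nets below are indexed by
  directed preordered subsets of the type \<open>'a set \<times> 'a\<close>. Nothing is lost: by the lemmas
  \<open>order_adherenceI\<close> and \<open>uo_adherenceI\<close>, limits of nets in \<open>A\<close> over any index type belong
  to these sets.
\<close>

definition order_adherence :: "'a::lattice_ab_group_add_abs set \<Rightarrow> 'a set"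
  where "order_adherence A = {l. \<exists>(I :: ('a set \<times> 'a) set) le f.
    directed_on I le \<and> f ` I \<subseteq> A \<and> order_converges I le f l}"

definition uo_adherence :: "'a::lattice_ab_group_add_abs set \<Rightarrow> 'a set"
  where "uo_adherence A = {l. \<exists>(I :: ('a set \<times> 'a) set) le f.
    directed_on I le \<and> f ` I \<subseteq> A \<and> uo_converges I le f l}"

lemma reindex_net:
  fixes f :: "'i \<Rightarrow> 'a"
  assumes "directed_on I le" and "f ` I \<subseteq> A"
  obtains J :: "('a set \<times> 'a) set" and le' g where "directed_on J le'" "g ` J \<subseteq> A"
    "\<And>P. (\<exists>i\<^sub>0\<in>I. \<forall>i\<in>I. le i\<^sub>0 i \<longrightarrow> P (f i)) \<Longrightarrow> (\<exists>j\<^sub>0\<in>J. \<forall>j\<in>J. le' j\<^sub>0 j \<longrightarrow> P (g j))"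
proof -
  define tail where "tail i = f ` {k\<in>I. le i k}" for i
  define J where "J = {(T, x). \<exists>i\<in>I. T = tail i \<and> x \<in> T}"
  define le' where "le' a b \<longleftrightarrow> fst b \<subseteq> fst a" for a b :: "'a set \<times> 'a"
  have I: "I \<noteq> {}" "\<And>i. i \<in> I \<Longrightarrow> le i i"
    "\<And>i j k. \<lbrakk>i \<in> I; j \<in> I; k \<in> I; le i j; le j k\<rbrakk> \<Longrightarrow> le i k"
    "\<And>i j. \<lbrakk>i \<in> I; j \<in> I\<rbrakk> \<Longrightarrow> \<exists>k\<in>I. le i k \<and> le j k"
    using assms(1) unfolding directed_on_def by blast+
  have mem: "(tail i, f i) \<in> J" if "i \<in> I" for i
    using that I(2) by (auto simp: J_def tail_def)
  have mono: "tail k \<subseteq> tail i" if "i \<in> I" "k \<in> I" "le i k" for i k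
    unfolding tail_def using that by (blast intro: I(3))
  have ub: "\<exists>c\<in>J. le' a c \<and> le' b c" if ab: "a \<in> J" "b \<in> J" for a b
  proof -
    obtain i j where ij: "i \<in> I" "fst a = tail i" "j \<in> I" "fst b = tail j"
      using ab by (auto simp: J_def)
    then obtain k where "k \<in> I" "le i k" "le j k" using I(4) by blast
    then show ?thesis using ij mono mem by (intro bexI[of _ "(tail k, f k)"]) (auto simp: le'_def)
  qed
  have "J \<noteq> {}" using I(1) mem by blast
  with ub have "directed_on J le'" unfolding directed_on_def by (auto simp: le'_def)
  moreover have "snd ` J \<subseteq> A" using assms(2) by (auto simp: J_def tail_def)
  moreover have "\<exists>j\<^sub>0\<in>J. \<forall>j\<in>J. le' j\<^sub>0 j \<longrightarrow> P (snd j)"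
    if ev: "\<exists>i\<^sub>0\<in>I. \<forall>i\<in>I. le i\<^sub>0 i \<longrightarrow> P (f i)" for P
  proof -
    obtain i where i: "i \<in> I" "\<And>x. x \<in> tail i \<Longrightarrow> P x"
      using ev unfolding tail_def by blast
    then show ?thesis
      by (intro bexI[OF _ mem[OF i(1)]]) (auto simp: le'_def J_def)
  qed
  ultimately show ?thesis by (rule that)
qed

lemma order_adherenceI:
  fixes f :: "'i \<Rightarrow> 'a::lattice_ab_group_add_abs"
  assumes "directed_on I le" "f ` I \<subseteq> A" "order_converges I le f l"
  shows "l \<in> order_adherence A"
proof -
  obtain J :: "('a set \<times> 'a) set" and le' g where J: "directed_on J le'" "g ` J \<subseteq> A"
    and ev: "\<And>P. (\<exists>i\<^sub>0\<in>I. \<forall>i\<in>I. le i\<^sub>0 i \<longrightarrow> P (f i)) \<Longrightarrow> (\<exists>j\<^sub>0\<in>J. \<forall>j\<in>J. le' j\<^sub>0 j \<longrightarrow> P (g j))"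
    by (rule reindex_net[OF assms(1,2)]) blast
  obtain Q where Q: "Q \<down> 0" "\<And>q. q \<in> Q \<Longrightarrow> \<exists>i\<^sub>0\<in>I. \<forall>i\<in>I. le i\<^sub>0 i \<longrightarrow> \<bar>f i - l\<bar> \<le> q"
    using assms(3) unfolding order_converges_def by blast
  have "order_converges J le' g l"
    unfolding order_converges_def
    using Q(1) ev[of "\<lambda>x. \<bar>x - l\<bar> \<le> q" for q, OF Q(2)] by blast
  with J show ?thesis unfolding order_adherence_def by blast
qed

lemma uo_adherenceI:
  fixes f :: "'i \<Rightarrow> 'a::lattice_ab_group_add_abs"
  assumes "directed_on I le" "f ` I \<subseteq> A" "uo_converges I le f l"
  shows "l \<in> uo_adherence A"
proof -
  obtain J :: "('a set \<times> 'a) set" and le' g where J: "directed_on J le'" "g ` J \<subseteq> A"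
    and ev: "\<And>P. (\<exists>i\<^sub>0\<in>I. \<forall>i\<in>I. le i\<^sub>0 i \<longrightarrow> P (f i)) \<Longrightarrow> (\<exists>j\<^sub>0\<in>J. \<forall>j\<in>J. le' j\<^sub>0 j \<longrightarrow> P (g j))"
    by (rule reindex_net[OF assms(1,2)]) blast
  have "order_converges J le' (\<lambda>p. inf \<bar>g p - l\<bar> e) 0" if "e \<ge> 0" for e
  proof -
    have "order_converges I le (\<lambda>p. inf \<bar>f p - l\<bar> e) 0"
      using assms(3) that unfolding uo_converges_def by blast
    then obtain Q where Q: "Q \<down> 0"
      "\<And>q. q \<in> Q \<Longrightarrow> \<exists>i\<^sub>0\<in>I. \<forall>i\<in>I. le i\<^sub>0 i \<longrightarrow> abs (inf \<bar>f i - l\<bar> e - 0) \<le> q"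
      unfolding order_converges_def by blast
    have "\<exists>j\<^sub>0\<in>J. \<forall>j\<in>J. le' j\<^sub>0 j \<longrightarrow> abs (inf \<bar>g j - l\<bar> e - 0) \<le> q" if "q \<in> Q" for q
      by (rule ev[of "\<lambda>x. abs (inf \<bar>x - l\<bar> e - 0) \<le> q", OF Q(2)[OF that]])
    with Q(1) show ?thesis unfolding order_converges_def by blast
  qed
  with J show ?thesis unfolding uo_adherence_def uo_converges_def by blast
qed

definition demicontinuous :: "'a::normed_lattice itself \<Rightarrow> bool"
  where "demicontinuous _ \<longleftrightarrow> (\<exists>r::real. r \<ge> 1 \<and>
    (\<forall>P (f::'a). P \<subseteq> cball 0 1 \<inter> {x. 0 \<le> x} \<longrightarrow> P \<up> f \<longrightarrow> norm f \<le> r))"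

end

theory Submission
  imports Defs
begin

text \<open>
  A vector \<open>l\<close> is a uo limit of a net in the ball of radius \<open>c\<close> iff \<open>P \<up> \<bar>l\<bar>\<close> for some set \<open>P\<close> of
  positive elements of that ball, and it is then even an order limit. If \<open>\<bar>f p - l\<bar> \<sqinter> \<bar>l\<bar>\<close> is
  eventually dominated by each element of \<open>Q \<down> 0\<close>, then \<open>(\<bar>l\<bar> - q)\<^sup>+ \<le> \<bar>f p\<bar>\<close> for large \<open>p\<close>, so
  \<open>P = {(\<bar>l\<bar> - q)\<^sup>+ | q \<in> Q}\<close> will do. Conversely, the truncations of \<open>l\<close> to \<open>[-p, p]\<close> for \<open>p \<in> P\<close>
  order converge to \<open>l\<close>. All equivalences follow from this by scaling.
\<close>

lemma isLub_UNIV_iff: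
  "isLub UNIV P f \<longleftrightarrow> (\<forall>x\<in>P. x \<le> f) \<and> (\<forall>u. (\<forall>x\<in>P. x \<le> u) \<longrightarrow> f \<le> u)"
  by (auto simp: isLub_def leastP_def isUb_def setle_def setge_def)

lemma isGlb_UNIV_iff:
  "isGlb UNIV P f \<longleftrightarrow> (\<forall>x\<in>P. f \<le> x) \<and> (\<forall>u. (\<forall>x\<in>P. u \<le> x) \<longrightarrow> u \<le> f)"
  by (auto simp: isGlb_def greatestP_def isLb_def setle_def setge_def)

text \<open>The order on the image is kept separate from the order on the index set. The lemma thus
  covers monotone maps as well as antitone maps that exchange \<open>(\<le>)\<close> and
  \<open>(\<ge>)\<close>.\<close>

lemma directed_on_image:
  fixes le' (infix \<open>\<sqsubseteq>\<close> 50)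
  assumes "directed_on I le" and "\<And>i j. i \<in> I \<Longrightarrow> j \<in> I \<Longrightarrow> le i j \<Longrightarrow> h i \<sqsubseteq> h j"
    and "\<And>x. x \<sqsubseteq> x" and "\<And>x y z. x \<sqsubseteq> y \<Longrightarrow> y \<sqsubseteq> z \<Longrightarrow> x \<sqsubseteq> z"
  shows "directed_on (h ` I) (\<sqsubseteq>)"
proof -
  have "\<exists>k\<in>I. h i \<sqsubseteq> h k \<and> h j \<sqsubseteq> h k" if "i \<in> I" "j \<in> I" for i j
    using assms(1) that assms(2) unfolding directed_on_def by meson
  moreover have "I \<noteq> {}" using assms(1) by (simp add: directed_on_def)
  ultimately show ?thesis
    unfolding directed_on_def by (auto intro: assms(3,4))
qed

text \<open>This supplies the dominating set \<open>Q\<close> for the order convergence of the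
  truncations.\<close>

lemma up_to_minus:
  fixes P :: "'a::ordered_ab_group_add set"
  assumes "P \<up> f"
  shows "(\<lambda>p. f - p) ` P \<down> 0"
proof -
  have P: "directed_on P (\<le>)" "\<And>x. x \<in> P \<Longrightarrow> x \<le> f"
    "\<And>u. (\<And>x. x \<in> P \<Longrightarrow> x \<le> u) \<Longrightarrow> f \<le> u"
    using assms unfolding up_to_def isLub_UNIV_iff by blast+
  have "directed_on ((\<lambda>p. f - p) ` P) (\<ge>)"
    by (rule directed_on_image[OF P(1)]) (auto intro: diff_left_mono)
  moreover have "u \<le> 0" if "\<And>p. p \<in> P \<Longrightarrow> u \<le> f - p" for u
  proof -
    have "f \<le> f - u" using that by (intro P(3)) (simp add: algebra_simps)
    then show ?thesis by (simp add: algebra_simps)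
  qed
  ultimately show ?thesis
    unfolding down_to_def isGlb_UNIV_iff using P(2) by auto
qed

lemma up_to_scaleR:
  fixes P :: "'a::ordered_real_vector set"
  assumes "P \<up> f" and "c > 0"
  shows "(\<lambda>p. c *\<^sub>R p) ` P \<up> c *\<^sub>R f"
proof -
  have P: "directed_on P (\<le>)" "\<And>x. x \<in> P \<Longrightarrow> x \<le> f"
    "\<And>u. (\<And>x. x \<in> P \<Longrightarrow> x \<le> u) \<Longrightarrow> f \<le> u"
    using assms unfolding up_to_def isLub_UNIV_iff by blast+
  have "directed_on ((\<lambda>p. c *\<^sub>R p) ` P) (\<le>)"
    using \<open>c > 0\<close> by (intro directed_on_image[OF P(1)]) (auto intro: scaleR_left_mono)
  moreover have "c *\<^sub>R f \<le> u" if "\<And>p. p \<in> P \<Longrightarrow> c *\<^sub>R p \<le> u" for u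
  proof -
    have "f \<le> u /\<^sub>R c"
      using that \<open>c > 0\<close> by (intro P(3)) (simp add: pos_le_divideR_eq)
    then show ?thesis using \<open>c > 0\<close> by (simp add: pos_le_divideR_eq)
  qed
  ultimately show ?thesis
    unfolding up_to_def isLub_UNIV_iff
    using P(2) \<open>c > 0\<close> by (auto intro: scaleR_left_mono)
qed

lemma norm_abs_eq: "norm \<bar>x\<bar> = norm x" for x :: "'a::normed_lattice"
  by (rule antisym; rule norm_solid) simp_all

text \<open>One set \<open>Q\<close> serves every \<open>e\<close>: cutting
  \<open>\<bar>f p - l\<bar>\<close> down by \<open>e \<ge> 0\<close> leaves it positive and does
  not enlarge it.\<close>

lemma order_converges_imp_uo_converges:
  assumes "order_converges I le f l"
  shows "uo_converges I le f l"
proof -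
  obtain Q where Q: "Q \<down> 0" "\<And>q. q \<in> Q \<Longrightarrow> \<exists>i\<in>I. \<forall>p\<in>I. le i p \<longrightarrow> \<bar>f p - l\<bar> \<le> q"
    using assms unfolding order_converges_def by blast
  have "abs (inf \<bar>f p - l\<bar> e - 0) \<le> \<bar>f p - l\<bar>" if "e \<ge> 0" for e p
    using that by simp
  then show ?thesis
    unfolding uo_converges_def order_converges_def using Q by (meson order_trans)
qed

lemma order_adherence_subset_uo_adherence: "order_adherence A \<subseteq> uo_adherence A"
  unfolding order_adherence_def uo_adherence_def
  using order_converges_imp_uo_converges by blast

lemma uo_adherence_cball_imp_up_to:
  fixes l :: "'a::normed_lattice"
  assumes "l \<in> uo_adherence (cball 0 c)"
  obtains P where "P \<subseteq> cball 0 c \<inter> {x. 0 \<le> x}" and "P \<up> \<bar>l\<bar>"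
proof -
  obtain I :: "('a set \<times> 'a) set" and le f where
    I: "directed_on I le" "f ` I \<subseteq> cball 0 c" and "uo_converges I le f l"
    using assms unfolding uo_adherence_def by blast
  \<comment> \<open>The single test element \<open>e = \<bar>l\<bar>\<close> is enough here.\<close>
  then have "order_converges I le (\<lambda>p. inf \<bar>f p - l\<bar> \<bar>l\<bar>) 0"
    unfolding uo_converges_def by simp
  then obtain Q where Q: "Q \<down> 0"
    and conv: "\<And>q. q \<in> Q \<Longrightarrow> \<exists>i\<in>I. \<forall>p\<in>I. le i p \<longrightarrow> abs (inf \<bar>f p - l\<bar> \<bar>l\<bar> - 0) \<le> q"
    unfolding order_converges_def by blast
  from Q have dir: "directed_on Q (\<ge>)" and lb: "\<And>q. q \<in> Q \<Longrightarrow> 0 \<le> q"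
    and glb: "\<And>u. (\<And>q. q \<in> Q \<Longrightarrow> u \<le> q) \<Longrightarrow> u \<le> 0"
    unfolding down_to_def isGlb_UNIV_iff by blast+
  let ?h = "\<lambda>q. sup 0 (\<bar>l\<bar> - q)"
  have "norm (?h q) \<le> c" if q: "q \<in> Q" for q
  proof -
    obtain i where i: "i \<in> I" "\<forall>p\<in>I. le i p \<longrightarrow> abs (inf \<bar>f p - l\<bar> \<bar>l\<bar> - 0) \<le> q"
      using conv[OF q] by blast
    \<comment> \<open>By reflexivity the estimate holds at the threshold index itself, so one member
      \<open>f i\<close> of the net bounds the norm of \<open>?h q\<close>.\<close>
    have "le i i" using I(1) i(1) unfolding directed_on_def by blast
    then have *: "inf \<bar>f i - l\<bar> \<bar>l\<bar> \<le> q" using i by auto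
    have "\<bar>l\<bar> - \<bar>f i\<bar> \<le> \<bar>f i - l\<bar>"
      by (metis abs_minus_commute abs_triangle_ineq2)
    \<comment> \<open>The left side lies below both arguments of the infimum, below
      \<open>\<bar>l\<bar>\<close> because \<open>\<bar>f i\<bar>\<close> is positive.\<close>
    then have "\<bar>l\<bar> - \<bar>f i\<bar> \<le> inf \<bar>f i - l\<bar> \<bar>l\<bar>"
      by (simp add: algebra_simps)
    with * have "\<bar>l\<bar> - q \<le> \<bar>f i\<bar>"
      by (metis diff_le_eq add.commute order_trans)
    then have "\<bar>?h q\<bar> \<le> \<bar>f i\<bar>" by (simp add: abs_of_nonneg)
    then have "norm (?h q) \<le> norm (f i)" by (rule norm_solid)
    also have "\<dots> \<le> c" using I(2) i(1) by auto
    finally show ?thesis .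
  qed
  then have "?h ` Q \<subseteq> cball 0 c \<inter> {x. 0 \<le> x}" by auto
  moreover have "?h ` Q \<up> \<bar>l\<bar>"
  proof -
    have "directed_on (?h ` Q) (\<le>)"
      by (rule directed_on_image[OF dir]) (simp_all add: le_supI2 diff_left_mono)
    moreover have "\<bar>l\<bar> \<le> u" if "\<And>q. q \<in> Q \<Longrightarrow> ?h q \<le> u" for u
    proof -
      \<comment> \<open>From \<open>\<bar>l\<bar> - q \<le> ?h q \<le> u\<close> the vector
        \<open>\<bar>l\<bar> - u\<close> is a lower bound of \<open>Q\<close>, whose infimum is
        0.\<close>
      have "\<bar>l\<bar> - u \<le> 0"
        using that by (intro glb) (simp add: algebra_simps)
      then show ?thesis by simp
    qed
    ultimately show ?thesis
      unfolding up_to_def isLub_UNIV_iff using lb by auto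
  qed
  ultimately show ?thesis by (rule that)
qed

text \<open>For real numbers the distance from \<open>l\<close> to its truncation to
  \<open>[-p, p]\<close> is exactly \<open>\<bar>l\<bar> - p\<close>. In the lattice,
  \<open>l - d \<le> ?x \<le> l + d\<close> with \<open>d = \<bar>l\<bar> - p\<close> is checked on
  the two parts of \<open>?x\<close> by means of
  \<open>\<plusminus>l \<le> \<bar>l\<bar>\<close>.\<close>

lemma truncation_bounds:
  fixes l p :: "'a::lattice_ab_group_add_abs"
  assumes "0 \<le> p" and "p \<le> \<bar>l\<bar>"
  shows "\<bar>sup (inf l p) (- p)\<bar> \<le> p" and "\<bar>sup (inf l p) (- p) - l\<bar> \<le> \<bar>l\<bar> - p"
proof -
  let ?x = "sup (inf l p) (- p)"
  have "- p \<le> p" using assms(1) by (meson neg_le_0_iff_le order_trans)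
  then have "?x \<le> p" "- ?x \<le> p"
    by (simp_all add: minus_le_iff)
  then show "\<bar>?x\<bar> \<le> p" by (rule abs_leI)
  have "?x \<le> l + (\<bar>l\<bar> - p)"
  proof (rule le_supI)
    show "inf l p \<le> l + (\<bar>l\<bar> - p)"
      using assms(2) by (intro le_infI1) simp
    have "0 \<le> l + \<bar>l\<bar>"
      using abs_ge_minus_self[of l] by (metis add.commute diff_ge_0_iff_ge diff_minus_eq_add)
    then show "- p \<le> l + (\<bar>l\<bar> - p)" by (simp add: algebra_simps)
  qed
  moreover have "l - (\<bar>l\<bar> - p) \<le> ?x"
  proof (intro le_supI1 le_infI)
    show "l - (\<bar>l\<bar> - p) \<le> l" using assms(2) by simp
    show "l - (\<bar>l\<bar> - p) \<le> p" using abs_ge_self[of l] by (simp add: algebra_simps)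
  qed
  moreover have "\<bar>x - l\<bar> \<le> d" if "x \<le> l + d" "l - d \<le> x" for x d
    using that by (intro abs_leI) (simp_all add: algebra_simps)
  ultimately show "\<bar>?x - l\<bar> \<le> \<bar>l\<bar> - p" by blast
qed

lemma up_to_imp_order_adherence_cball:
  fixes l :: "'a::normed_lattice"
  assumes P: "P \<subseteq> cball 0 c \<inter> {x. 0 \<le> x}" and up: "P \<up> \<bar>l\<bar>"
  shows "l \<in> order_adherence (cball 0 c)"
\<comment> \<open>The net of truncations is indexed by \<open>P\<close> with its own order, so its
  index type is not the one in the definition of \<open>order_adherence\<close>.\<close>
proof (rule order_adherenceI)
  let ?x = "\<lambda>p. sup (inf l p) (- p)"
  have le: "p \<le> \<bar>l\<bar>" if "p \<in> P" for p
    using up that unfolding up_to_def isLub_UNIV_iff by blast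
  show "directed_on P (\<le>)" using up unfolding up_to_def by blast
  have "norm (?x p) \<le> c" if "p \<in> P" for p
  proof -
    have "0 \<le> p" "norm p \<le> c" using P that by auto
    then show ?thesis
      using truncation_bounds(1)[OF \<open>0 \<le> p\<close> le[OF that]] norm_solid[of "?x p" p] by simp
  qed
  then show "?x ` P \<subseteq> cball 0 c" by auto
  have "\<bar>?x p - l\<bar> \<le> \<bar>l\<bar> - p\<^sub>0" if "p \<in> P" "p\<^sub>0 \<le> p" for p\<^sub>0 p
  proof -
    have "\<bar>?x p - l\<bar> \<le> \<bar>l\<bar> - p"
      using P that by (intro truncation_bounds le) auto
    also have "\<dots> \<le> \<bar>l\<bar> - p\<^sub>0" using that by (simp add: diff_left_mono)
    finally show ?thesis .
  qed
  then show "order_converges P (\<le>) ?x l"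
    unfolding order_converges_def
    by (intro exI[of _ "(\<lambda>p. \<bar>l\<bar> - p) ` P"] conjI up_to_minus[OF up]) blast
qed

lemma order_adherence_cball_eq_uo_adherence:
  "order_adherence (cball 0 c :: 'a::normed_lattice set) = uo_adherence (cball 0 c)"
proof (intro equalityI order_adherence_subset_uo_adherence subsetI)
  fix l :: 'a assume "l \<in> uo_adherence (cball 0 c)"
  then obtain P where "P \<subseteq> cball 0 c \<inter> {x. 0 \<le> x}" and "P \<up> \<bar>l\<bar>"
    by (rule uo_adherence_cball_imp_up_to)
  then show "l \<in> order_adherence (cball 0 c)" by (rule up_to_imp_order_adherence_cball)
qed

lemma uo_adherence_mono: "A \<subseteq> B \<Longrightarrow> uo_adherence A \<subseteq> uo_adherence B"
proof
  fix l assume "A \<subseteq> B" and "l \<in> uo_adherence A"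
  then obtain I :: "('a set \<times> 'a) set" and le f where
    "directed_on I le" "f ` I \<subseteq> B" "uo_converges I le f l"
    unfolding uo_adherence_def by blast
  then show "l \<in> uo_adherence B" by (rule uo_adherenceI)
qed

lemma demicontinuous_imp_bounded_uo_adherence:
  fixes A :: "'a::normed_lattice set"
  assumes "demicontinuous TYPE('a)" and "bounded A"
  shows "bounded (uo_adherence A)"
proof -
  obtain r where r: "\<And>P (f::'a). P \<subseteq> cball 0 1 \<inter> {x. 0 \<le> x} \<Longrightarrow> P \<up> f \<Longrightarrow> norm f \<le> r"
    using assms(1) unfolding demicontinuous_def by blast
  obtain c where c: "c > 0" "A \<subseteq> cball 0 c"
    using assms(2) unfolding bounded_pos subset_iff mem_cball_0 by blast
  have "norm l \<le> c * r" if "l \<in> uo_adherence A" for l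
  proof -
    have "l \<in> uo_adherence (cball 0 c)" using uo_adherence_mono[OF c(2)] that by blast
    then obtain P where P: "P \<subseteq> cball 0 c \<inter> {x. 0 \<le> x}" "P \<up> \<bar>l\<bar>"
      by (rule uo_adherence_cball_imp_up_to)
    \<comment> \<open>The constant \<open>r\<close> concerns the unit ball only. Shrinking
      \<open>P\<close> by the factor \<open>1/c\<close> puts it there and turns \<open>r\<close>
      into the bound \<open>c * r\<close>.\<close>
    have "(\<lambda>p. inverse c *\<^sub>R p) ` P \<subseteq> cball 0 1 \<inter> {x. 0 \<le> x}"
      using P(1) c(1) by (auto simp: field_simps scaleR_nonneg_nonneg)
    moreover have "(\<lambda>p. inverse c *\<^sub>R p) ` P \<up> inverse c *\<^sub>R \<bar>l\<bar>"
      using P(2) c(1) by (intro up_to_scaleR) auto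
    ultimately have "norm (inverse c *\<^sub>R \<bar>l\<bar>) \<le> r" by (rule r)
    then show ?thesis using c(1) by (simp add: norm_abs_eq field_simps)
  qed
  then show ?thesis unfolding bounded_iff by blast
qed

lemma bounded_order_adherence_imp_demicontinuous:
  assumes "bounded (order_adherence (cball 0 1 :: 'a::normed_lattice set))"
  shows "demicontinuous TYPE('a)"
proof -
  obtain r where r: "\<And>l. l \<in> order_adherence (cball 0 1 :: 'a set) \<Longrightarrow> norm l \<le> r"
    using assms unfolding bounded_iff by blast
  \<comment> \<open>The maximum with 1 meets the demand \<open>r \<ge> 1\<close> in
    \<open>demicontinuous\<close>.\<close>
  have "norm f \<le> max 1 r" if P: "P \<subseteq> cball 0 1 \<inter> {x. 0 \<le> x}" "P \<up> f" for P and f :: 'a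
  proof -
    \<comment> \<open>A directed set is nonempty, which forces \<open>f \<ge> 0\<close>. Hence
      \<open>P \<up> f\<close> reads \<open>P \<up> \<bar>f\<bar>\<close>, and \<open>f\<close>
      itself is an order limit.\<close>
    obtain p where "p \<in> P" using P(2) unfolding up_to_def directed_on_def by blast
    then have "0 \<le> p" "p \<le> f" using P unfolding up_to_def isLub_UNIV_iff by auto
    then have "\<bar>f\<bar> = f" by (intro abs_of_nonneg) (rule order_trans)
    then have "norm f \<le> r" using P by (intro r up_to_imp_order_adherence_cball) auto
    then show ?thesis by simp
  qed
  then show ?thesis unfolding demicontinuous_def by (intro exI[of _ "max 1 r"]) auto
qed

theorem proposition3p8:
  shows
    "order_adherence (cball 0 1 :: 'a::normed_lattice set) = uo_adherence (cball 0 1) \<and>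
     (demicontinuous TYPE('a) \<longleftrightarrow> bounded (order_adherence (cball 0 1 :: 'a set))) \<and>
     (demicontinuous TYPE('a) \<longleftrightarrow> (\<forall>A :: 'a set. bounded A \<longrightarrow> bounded (order_adherence A))) \<and>
     (demicontinuous TYPE('a) \<longleftrightarrow> (\<forall>A :: 'a set. bounded A \<longrightarrow> bounded (uo_adherence A)))"
  \<comment> \<open>Demicontinuity bounds the uo adherences of bounded sets, and with them the
    smaller order adherences. Either property, applied to the unit ball, where both adherences
    agree, returns demicontinuity.\<close>
  using order_adherence_cball_eq_uo_adherence[where 'a = 'a]
    demicontinuous_imp_bounded_uo_adherence[where 'a = 'a]
    bounded_order_adherence_imp_demicontinuous[where 'a = 'a]
    order_adherence_subset_uo_adherence[where 'a = 'a]
  by (metis bounded_cball bounded_subset)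

end
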